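(* Let $\mathcal{A}$ be a finite set of agents and let $G_c=(\mathcal{V},\mathcal{F},c)$ be a 2-coloured graph whose vertex set $\mathcal{V}\subseteq 2^{\mathcal{A}}$ is a partition of $\mathcal{A}$ into nonempty coalitions. Then the search tree rooted at $G_c$ contains all the coalition structures compatible with $G_c$, each appearing only once; that is, for every coalition structure $CS$ compatible with $G_c$ there is exactly one node of the search tree rooted at $G_c$ whose vertex set is $CS$.
   Context: A coalition is a nonempty subset of $\mathcal{A}$; a coalition structure is a partition of $\mathcal{A}$ into coalitions. A 2-coloured graph $G_c=(\mathcal{V},\mathcal{F},c)$ is a finite simple undirected graph with vertex set $\mathcal{V}\subseteq 2^{\mathcal{A}}$ (here a partition of $\mathcal{A}$ into coalitions), edge set $\mathcal{F}$, and a colouring $c:\mathcal{F}\to\{red,green\}$. The coalition structure represented by $G_c$ is its vertex set $\mathcal{V}$. Green edge contraction: given a green edge $e=(u,v)\in\mathcal{F}$, the contraction of $e$ in $G_c$ is the 2-coloured graph obtained by removing $e$, $u$ and $v$, adding a new vertex $w=u\cup v$, and making each other edge incident to $u$ or $v$ incident to $w$ instead (with its colour). If two parallel edges result, they are merged into one edge, coloured red if at least one of them is red, and green otherwise. Children: let $e_1,\dots,e_k$ be the green edges of $G_c$, listed in some order (any order may be chosen for each node). For $1\le i\le k$, the $i$-th child of $G_c$ is the contraction of $e_i$ in the graph obtained from $G_c$ by recolouring $e_1,\dots,e_{i-1}$ red. A graph with no green edges has no children. Search tree rooted at $G_c$: the rooted tree with root $G_c$ in which each node is a 2-coloured graph $H$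 and, if $h_1,\dots,h_k$ are the green edges of $H$ listed in the order chosen for that node, the node $H$ has exactly $k$ children, the $i$-th being the contraction of $h_i$ in the graph obtained from $H$ by recolouring $h_1,\dots,h_{i-1}$ red (this is the tree generated and traversed depth-first by the exhaustive algorithm SolveGCCF started at $G_c$). Compatible: a coalition structure $CS$ is compatible with $G_c=(\mathcal{V},\mathcal{F},c)$ if every coalition of $CS$ is a union of elements of $\mathcal{V}$, the set of elements of $\mathcal{V}$ contained in any given coalition of $CS$ induces a connected subgraph of $(\mathcal{V},\mathcal{F})$, and no red edge of $G_c$ has both of its endpoints contained in the same coalition of $CS$. *)

theory Defs
  imports Main "HOL-Library.Disjoint_Sets"
begin

datatype colour = Red | Green

text \<open>Vertices are coalitions, that is, sets of agents of type \<open>'a\<close>; an edge is the set of its two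
  endpoints.  Only the values of \<open>colouring\<close> on \<open>edges\<close> matter.\<close>

record 'a cgraph =
  vertices :: "'a set set"
  edges :: "'a set set set"
  colouring :: "'a set set \<Rightarrow> colour"

definition two_coloured_graph :: "'a cgraph \<Rightarrow> bool" where
  "two_coloured_graph G \<longleftrightarrow>
     finite (vertices G) \<and> (\<forall>f\<in>edges G. f \<subseteq> vertices G \<and> card f = 2)"

definition green_edges :: "'a cgraph \<Rightarrow> 'a set set set" where
  "green_edges G = {f \<in> edges G. colouring G f = Green}"

definition recolour_red :: "'a set set set \<Rightarrow> 'a cgraph \<Rightarrow> 'a cgraph" where
  "recolour_red E G = G\<lparr>colouring := (\<lambda>f. if f \<in> E then Red else colouring G f)\<rparr>"

text \<open>Contracting \<open>e = {u, v}\<close> maps both endpoints to \<open>\<Union>e = u \<union> v\<close>.  Parallel edges are merged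
  because edges are sets of endpoints; a resulting edge is red iff some edge it comes from is.\<close>

definition redirect :: "'a set set \<Rightarrow> 'a set \<Rightarrow> 'a set" where
  "redirect e x = (if x \<in> e then \<Union>e else x)"

definition contract :: "'a set set \<Rightarrow> 'a cgraph \<Rightarrow> 'a cgraph" where
  "contract e G =
     \<lparr>vertices = insert (\<Union>e) (vertices G - e),
      edges = (\<lambda>f. redirect e ` f) ` (edges G - {e}),
      colouring = (\<lambda>g. if \<exists>f\<in>edges G - {e}. redirect e ` f = g \<and> colouring G f = Red
                       then Red else Green)\<rparr>"

text \<open>Children are numbered from 0: child \<open>i\<close> contracts \<open>es ! i\<close> after the \<open>i\<close> earlier edges
  \<open>es ! 0, \<dots>, es ! (i - 1)\<close> have been recoloured red.\<close>

definition child :: "'a cgraph \<Rightarrow> 'a set set list \<Rightarrow> nat \<Rightarrow> 'a cgraph" where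
  "child G es i = contract (es ! i) (recolour_red (set (take i es)) G)"

datatype 'a stree = Node (root: "'a cgraph") (subtrees: "'a stree list")

text \<open>The order \<open>es\<close> of the green edges is chosen anew at each occurrence of a node, so a graph may
  have several search trees.\<close>

inductive search_tree :: "'a stree \<Rightarrow> bool" where
  "\<lbrakk>distinct es; set es = green_edges H; length ts = length es;
    \<forall>i<length es. root (ts ! i) = child H es i \<and> search_tree (ts ! i)\<rbrakk>
   \<Longrightarrow> search_tree (Node H ts)"

text \<open>Nodes of a tree are positions (paths of child indices from the root), not graphs, so that a
  graph occurring at two positions counts as two nodes.  \<open>node_at T p\<close> is the graph at position
  \<open>p\<close>, and \<open>None\<close> if \<open>p\<close> is not a position of \<open>T\<close>.\<close>

fun node_at :: "'a stree \<Rightarrow> nat list \<Rightarrow> 'a cgraph option" where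
  "node_at (Node H ts) [] = Some H"
| "node_at (Node H ts) (i # p) = (if i < length ts then node_at (ts ! i) p else None)"

definition induces_connected :: "'a cgraph \<Rightarrow> 'a set set \<Rightarrow> bool" where
  "induces_connected G S \<longleftrightarrow>
     (\<forall>x\<in>S. \<forall>y\<in>S. (x, y) \<in> {(u, v). u \<in> S \<and> v \<in> S \<and> {u, v} \<in> edges G}\<^sup>*)"

definition coalition_structure :: "'a set \<Rightarrow> 'a set set \<Rightarrow> bool" where
  "coalition_structure A CS \<longleftrightarrow> partition_on A CS"

definition compatible :: "'a cgraph \<Rightarrow> 'a set set \<Rightarrow> bool" where
  "compatible G CS \<longleftrightarrow>
     (\<forall>C\<in>CS. \<exists>W\<subseteq>vertices G. C = \<Union>W) \<and>
     (\<forall>C\<in>CS. induces_connected G {v \<in> vertices G. v \<subseteq> C}) \<and>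
     (\<forall>f\<in>edges G. colouring G f = Red \<longrightarrow> \<not> (\<exists>C\<in>CS. \<forall>v\<in>f. v \<subseteq> C))"

lemma search_tree_exists:
  assumes "finite (edges G)"
  shows "\<exists>T. search_tree T \<and> root T = G"
  using assms
proof (induction "card (edges G)" arbitrary: G rule: less_induct)
  case less
  obtain es where es: "set es = green_edges G" "distinct es"
    using finite_distinct_list[of "green_edges G"] less.prems by (auto simp: green_edges_def)
  have "\<exists>T. search_tree T \<and> root T = child G es i" if "i < length es" for i
  proof (rule less.hyps)
    let ?F = "edges G - {es ! i}"
    have e: "es ! i \<in> edges G"
      using nth_mem[OF that] es by (auto simp: green_edges_def)
    have eq: "edges (child G es i) = (\<lambda>f. redirect (es ! i) ` f) ` ?F"
      by (simp add: child_def contract_def recolour_red_def)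
    show "finite (edges (child G es i))"
      using less.prems by (simp add: eq)
    have "card (edges (child G es i)) \<le> card ?F"
      using less.prems by (simp add: eq card_image_le)
    also have "\<dots> < card (edges G)"
      using less.prems e by (rule card_Diff1_less)
    finally show "card (edges (child G es i)) < card (edges G)" .
  qed
  then obtain t where t: "\<And>i. i < length es \<Longrightarrow> search_tree (t i) \<and> root (t i) = child G es i"
    by metis
  have "search_tree (Node G (map t [0..<length es]))"
    by (rule search_tree.intros[OF es(2,1)]) (use t in auto)
  then show ?case
    by (metis stree.sel(1))
qed

end

theory Submission
  imports Defs
begin

text \<open>Say that an edge is internal to \<open>CS\<close> if both its endpoints lie in one coalition of \<open>CS\<close>.
  Contracting a green edge \<open>e\<close> keeps exactly those compatible coalition structures to which \<open>e\<close> is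
  internal, and recolouring edges red keeps exactly those to which none of them is internal.
  Hence \<open>CS\<close> is compatible with the \<open>i\<close>-th child iff it is compatible with the parent and the
  \<open>i\<close>-th green edge is the first one internal to \<open>CS\<close>.  There is such an \<open>i\<close> iff \<open>CS\<close> is not the
  vertex set of the parent: an edge internal to the vertex set would be a loop, and if no
  edge is internal, connectedness makes every coalition of \<open>CS\<close> a single vertex.\<close>

text \<open>The assumptions on the root graph, bundled because contraction and recolouring preserve
  them, so that they hold at every node of the tree.\<close>

definition coalition_graph :: "'a set \<Rightarrow> 'a cgraph \<Rightarrow> bool" where
  "coalition_graph A G \<longleftrightarrow> two_coloured_graph G \<and> partition_on A (vertices G)"

definition internal :: "'a set set \<Rightarrow> 'a set set \<Rightarrow> bool" where
  "internal CS f \<longleftrightarrow> (\<exists>C\<in>CS. \<forall>v\<in>f. v \<subseteq> C)"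

section \<open>Partitions and refinement\<close>

lemma partition_on_subset_unique:
  assumes "partition_on A P" "C \<in> P" "D \<in> P" "x \<subseteq> C" "x \<subseteq> D" "x \<noteq> {}"
  shows "C = D"
  using assms by (meson disjnt_def disjointD disjoint_iff partition_onD2 subset_eq ex_in_conv)

text \<open>Refinement only asks that each vertex lie in some block, a condition that passes easily
  through \<open>redirect\<close>. From left to right, an agent \<open>a\<close> of a vertex
  \<open>x\<close> lies in a block that is a union of vertices, and the one containing
  \<open>a\<close> must be \<open>x\<close>. Conversely, each agent of \<open>C\<close> brings along
  its whole vertex.\<close>

lemma partition_on_unions_iff_refines:
  assumes P: "partition_on A P" and Q: "partition_on A Q"
  shows "(\<forall>C\<in>Q. \<exists>W\<subseteq>P. C = \<Union>W) \<longleftrightarrow> refines A P Q"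
proof
  assume L: "\<forall>C\<in>Q. \<exists>W\<subseteq>P. C = \<Union>W"
  have "\<exists>C\<in>Q. x \<subseteq> C" if x: "x \<in> P" for x
  proof -
    have ne: "x \<noteq> {}" using P x by (auto simp: partition_on_def)
    then obtain a where a: "a \<in> x" by blast
    then have "a \<in> A" using P x by (auto simp: partition_on_def)
    then obtain C where C: "C \<in> Q" "a \<in> C" using Q by (auto simp: partition_on_def)
    then obtain W where W: "W \<subseteq> P" "C = \<Union>W" using L by blast
    then obtain y where y: "y \<in> W" "a \<in> y" using C by blast
    have "x = y"
      using partition_on_subset_unique[OF P, of x y "{a}"] x y W a by auto
    then show ?thesis using C W y by blast
  qed
  then show "refines A P Q" using P Q by (simp add: refines_def)
next
  assume R: "refines A P Q"
  show "\<forall>C\<in>Q. \<exists>W\<subseteq>P. C = \<Union>W"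
  proof
    fix C assume C: "C \<in> Q"
    have "C \<subseteq> \<Union>{x \<in> P. x \<subseteq> C}"
    proof
      fix a assume a: "a \<in> C"
      then have "a \<in> A" using Q C by (auto simp: partition_on_def)
      then obtain x where x: "x \<in> P" "a \<in> x" using P by (auto simp: partition_on_def)
      then obtain D where D: "D \<in> Q" "x \<subseteq> D" using R by (auto simp: refines_def)
      have "C = D"
        using partition_on_subset_unique[OF Q C D(1), of "{a}"] a x D by auto
      then show "a \<in> \<Union>{x \<in> P. x \<subseteq> C}" using x D by blast
    qed
    then show "\<exists>W\<subseteq>P. C = \<Union>W"
      by (intro exI[of _ "{x \<in> P. x \<subseteq> C}"]) auto
  qed
qed

lemma compatible_iff:
  assumes "partition_on A (vertices G)" "partition_on A CS"
  shows "compatible G CS \<longleftrightarrow> refines A (vertices G) CS \<and>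
    (\<forall>C\<in>CS. induces_connected G {v \<in> vertices G. v \<subseteq> C}) \<and>
    (\<forall>f\<in>edges G. colouring G f = Red \<longrightarrow> \<not> internal CS f)"
  unfolding compatible_def internal_def partition_on_unions_iff_refines[OF assms] ..

lemma coalition_graph_edgeE:
  assumes "coalition_graph A G" "f \<in> edges G"
  obtains u v where "f = {u, v}" "u \<noteq> v" "u \<in> vertices G" "v \<in> vertices G" "u \<noteq> {}" "v \<noteq> {}"
    "u \<inter> v = {}"
proof -
  from assms have f: "f \<subseteq> vertices G" "card f = 2"
    by (auto simp: coalition_graph_def two_coloured_graph_def)
  then obtain u v where uv: "f = {u, v}" "u \<noteq> v" by (auto simp: card_2_iff)
  moreover have "partition_on A (vertices G)" using assms by (simp add: coalition_graph_def)
  ultimately show thesis using f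
    by (intro that[of u v]) (auto simp: partition_on_def disjoint_def)
qed

section \<open>Contraction as a map on vertices\<close>

lemma subset_redirect: "x \<subseteq> redirect e x"
  by (auto simp: redirect_def)

text \<open>The merged coalition \<open>\<Union>e\<close> cannot be an old vertex: it contains both
  endpoints, so it would equal each of them. Hence contraction identifies the endpoints of
  \<open>e\<close> and nothing else.\<close>

lemma redirect_eq_iff:
  assumes G: "coalition_graph A G" and e: "e \<in> edges G" and "x \<in> vertices G" "y \<in> vertices G"
  shows "redirect e x = redirect e y \<longleftrightarrow> x = y \<or> (x \<in> e \<and> y \<in> e)"
proof -
  have P: "partition_on A (vertices G)" using G by (simp add: coalition_graph_def)
  obtain u v where uv: "e = {u, v}" "u \<noteq> v" "u \<in> vertices G" "v \<in> vertices G" "u \<noteq> {}" "v \<noteq> {}"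
    using coalition_graph_edgeE[OF G e] by metis
  have "\<Union>e \<notin> vertices G"
  proof
    assume W: "\<Union>e \<in> vertices G"
    have "u = \<Union>e" "v = \<Union>e"
      using partition_on_subset_unique[OF P _ W, of u u]
        partition_on_subset_unique[OF P _ W, of v v] uv by auto
    then show False using uv(2) by metis
  qed
  then have "\<Union>e \<noteq> x" "\<Union>e \<noteq> y" using assms(3,4) by metis+
  then show ?thesis by (auto simp: redirect_def)
qed

text \<open>The image form turns quantifiers over new vertices into quantifiers over old
  ones.\<close>

lemma vertices_contract:
  assumes "coalition_graph A G" "e \<in> edges G"
  shows "vertices (contract e G) = redirect e ` vertices G"
proof -
  obtain u v where uv: "e = {u, v}" "u \<in> vertices G" "v \<in> vertices G"
    using coalition_graph_edgeE[OF assms] by metis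
  have "redirect e ` e = {\<Union>e}" unfolding uv(1) by (simp add: redirect_def)
  moreover have "redirect e ` (vertices G - e) = (\<lambda>x. x) ` (vertices G - e)"
    by (rule image_cong) (simp_all add: redirect_def)
  moreover have "vertices G = e \<union> (vertices G - e)" using uv by blast
  then have "redirect e ` vertices G = redirect e ` e \<union> redirect e ` (vertices G - e)"
    by (subst image_Un[symmetric]) (rule arg_cong)
  ultimately show ?thesis by (simp add: contract_def)
qed

lemma edges_contract: "edges (contract e G) = (`) (redirect e) ` (edges G - {e})"
  by (simp add: contract_def)

lemma colouring_contract_Red_iff:
  "colouring (contract e G) g = Red \<longleftrightarrow>
    (\<exists>f\<in>edges G - {e}. redirect e ` f = g \<and> colouring G f = Red)"
  by (simp add: contract_def)

text \<open>No other edge \<open>f\<close> becomes a loop: its endpoints could only be identified if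
  both were in \<open>e\<close>, which would force \<open>f = e\<close>.\<close>

lemma coalition_graph_contract:
  assumes G: "coalition_graph A G" and e: "e \<in> edges G"
  shows "coalition_graph A (contract e G)"
proof -
  have P: "partition_on A (vertices G)" and T: "two_coloured_graph G"
    using G by (simp_all add: coalition_graph_def)
  obtain u v where uv: "e = {u, v}" "u \<noteq> v" "u \<in> vertices G" "v \<in> vertices G" "u \<noteq> {}" "v \<noteq> {}"
    using coalition_graph_edgeE[OF G e] by metis
  have disj: "x \<inter> y = {}" if "x \<in> vertices G" "y \<in> vertices G" "x \<noteq> y" for x y
    using P that by (auto simp: partition_on_def disjoint_def)
  have "partition_on A (insert (\<Union>e) (vertices G - e))"
  proof (rule partition_onI)
    have "\<Union>(insert (\<Union>e) (vertices G - e)) = \<Union>(vertices G)" using uv by blast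
    then show "\<Union>(insert (\<Union>e) (vertices G - e)) = A" using P by (simp add: partition_on_def)
  next
    have w: "\<Union>e \<inter> x = {}" if "x \<in> vertices G - e" for x
      using disj[of u x] disj[of v x] uv that by auto
    fix p q assume "p \<in> insert (\<Union>e) (vertices G - e)" "q \<in> insert (\<Union>e) (vertices G - e)" "p \<noteq> q"
    then consider "p = \<Union>e" "q \<in> vertices G - e" | "q = \<Union>e" "p \<in> vertices G - e"
      | "p \<in> vertices G" "q \<in> vertices G" by blast
    then show "disjnt p q"
      using w[of p] w[of q] disj[of p q] \<open>p \<noteq> q\<close> by cases (simp_all add: disjnt_def Int_commute)
  next
    show "{} \<notin> insert (\<Union>e) (vertices G - e)" using uv P by (auto simp: partition_on_def)
  qed
  moreover have "finite (vertices (contract e G))"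
    using T by (auto simp: contract_def two_coloured_graph_def)
  moreover have "redirect e ` f \<subseteq> vertices (contract e G) \<and> card (redirect e ` f) = 2"
    if f: "f \<in> edges G" "f \<noteq> e" for f
  proof -
    obtain a b where ab: "f = {a, b}" "a \<noteq> b" "a \<in> vertices G" "b \<in> vertices G"
      using coalition_graph_edgeE[OF G f(1)] by metis
    have "redirect e a \<noteq> redirect e b"
      using redirect_eq_iff[OF G e ab(3,4)] ab f uv by auto
    then show ?thesis using ab by (auto simp: vertices_contract[OF G e])
  qed
  ultimately show ?thesis
    unfolding coalition_graph_def two_coloured_graph_def edges_contract
    by (auto simp: contract_def)
qed

lemma coalition_graph_recolour_red [simp]:
  "coalition_graph A (recolour_red E G) \<longleftrightarrow> coalition_graph A G"
  by (simp add: coalition_graph_def two_coloured_graph_def recolour_red_def)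

section \<open>Compatibility under contraction\<close>

lemma refines_contract_iff:
  assumes G: "coalition_graph A G" and e: "e \<in> edges G" and CS: "partition_on A CS"
  shows "refines A (vertices (contract e G)) CS \<longleftrightarrow>
    refines A (vertices G) CS \<and> internal CS e"
proof -
  have P: "partition_on A (vertices G)" "partition_on A (vertices (contract e G))"
    using G coalition_graph_contract[OF G e] by (simp_all add: coalition_graph_def)
  obtain u v where uv: "e = {u, v}" "u \<in> vertices G" "v \<in> vertices G"
    using coalition_graph_edgeE[OF G e] by metis
  \<comment> \<open>The left side is refinement for the contraction, read through
    \<open>vertices_contract\<close>. A block contains the merged vertex iff it contains both
    endpoints of \<open>e\<close>.\<close>
  have "(\<forall>x\<in>vertices G. \<exists>C\<in>CS. redirect e x \<subseteq> C) \<longleftrightarrow>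
    (\<forall>x\<in>vertices G. \<exists>C\<in>CS. x \<subseteq> C) \<and> internal CS e" (is "?L \<longleftrightarrow> ?R")
  proof
    assume L: ?L
    have "redirect e u = \<Union>e" using uv by (simp add: redirect_def)
    then have "\<exists>C\<in>CS. \<Union>e \<subseteq> C" using bspec[OF L uv(2)] by simp
    then have "internal CS e" unfolding internal_def by blast
    then show ?R using L subset_redirect by (meson subset_trans)
  next
    assume R: ?R
    then have "\<exists>C\<in>CS. \<Union>e \<subseteq> C" unfolding internal_def by blast
    then show ?L using R by (simp add: redirect_def)
  qed
  then show ?thesis
    using P CS by (simp add: refines_def vertices_contract[OF G e])
qed

text \<open>If \<open>x\<close> is an endpoint of \<open>e\<close>, then \<open>C\<close> and the
  block holding all of \<open>e\<close> share the nonempty set \<open>x\<close>, so they coincide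
  and \<open>C\<close> absorbs the merged vertex.\<close>

lemma redirect_subset_iff:
  assumes G: "coalition_graph A G" and e: "e \<in> edges G" and CS: "partition_on A CS"
    and int: "internal CS e" and x: "x \<in> vertices G" and C: "C \<in> CS"
  shows "redirect e x \<subseteq> C \<longleftrightarrow> x \<subseteq> C"
proof
  assume xC: "x \<subseteq> C"
  show "redirect e x \<subseteq> C"
  proof (cases "x \<in> e")
    case True
    obtain D where D: "D \<in> CS" "\<forall>v\<in>e. v \<subseteq> D" using int by (auto simp: internal_def)
    have "x \<noteq> {}" using G x by (auto simp: coalition_graph_def partition_on_def)
    then have "C = D" using partition_on_subset_unique[OF CS C D(1) xC] D True by blast
    then show ?thesis using D True by (auto simp: redirect_def)
  qed (use xC in \<open>simp add: redirect_def\<close>)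
next
  show "redirect e x \<subseteq> C \<Longrightarrow> x \<subseteq> C" by (rule subset_trans[OF subset_redirect])
qed

text \<open>Paths inside \<open>C\<close> are pushed forward along \<open>redirect e\<close>, where
  \<open>e\<close> collapses to a point, and lifted back, where \<open>e\<close> itself joins the
  two vertices that were merged.\<close>

lemma induces_connected_contract_iff:
  assumes G: "coalition_graph A G" and e: "e \<in> edges G" and CS: "partition_on A CS"
    and int: "internal CS e" and C: "C \<in> CS"
  shows "induces_connected (contract e G) {v \<in> vertices (contract e G). v \<subseteq> C} \<longleftrightarrow>
    induces_connected G {v \<in> vertices G. v \<subseteq> C}"
proof -
  let ?r = "redirect e"
  define S where "S = {v \<in> vertices G. v \<subseteq> C}"
  define S' where "S' = {v \<in> vertices (contract e G). v \<subseteq> C}"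
  define R where "R = {(u, v). u \<in> S \<and> v \<in> S \<and> {u, v} \<in> edges G}"
  define R' where "R' = {(u, v). u \<in> S' \<and> v \<in> S' \<and> {u, v} \<in> edges (contract e G)}"
  have sub: "?r x \<subseteq> C \<longleftrightarrow> x \<subseteq> C" if "x \<in> vertices G" for x
    using redirect_subset_iff[OF G e CS int that C] .
  have S': "S' = ?r ` S"
    unfolding S_def S'_def using sub by (auto simp: vertices_contract[OF G e])
  have same: "(x, y) \<in> R\<^sup>*" if "x \<in> S" "y \<in> S" "?r x = ?r y" for x y
  proof (cases "x = y")
    case False
    then have "x \<in> e" "y \<in> e" using redirect_eq_iff[OF G e] that by (auto simp: S_def)
    moreover obtain u v where "e = {u, v}" using coalition_graph_edgeE[OF G e] by metis
    ultimately have "e = {x, y}" using False by auto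
    then have "(x, y) \<in> R" using that e by (simp add: R_def)
    then show ?thesis ..
  qed simp
  have push: "(?r x, ?r y) \<in> R'\<^sup>*" if "(x, y) \<in> R\<^sup>*" for x y
    using that
  proof induction
    case (step y z)
    then have yz: "y \<in> S" "z \<in> S" "{y, z} \<in> edges G" by (simp_all add: R_def)
    have "(?r y, ?r z) \<in> R'\<^sup>*"
    proof (cases "{y, z} = e")
      case True
      then have "?r y = ?r z" by (auto simp: redirect_def)
      then show ?thesis by simp
    next
      case False
      then have "?r ` {y, z} \<in> edges (contract e G)"
        using yz unfolding edges_contract by blast
      then have "(?r y, ?r z) \<in> R'" using yz by (simp add: R'_def S')
      then show ?thesis ..
    qed
    with step.IH show ?case by (rule rtrancl_trans)
  qed simp
  \<comment> \<open>The claim covers every preimage of \<open>b\<close>, because the next lifted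
    edge may start at the other endpoint of \<open>e\<close>.\<close>
  have lift: "\<forall>y\<in>S. ?r y = b \<longrightarrow> (x, y) \<in> R\<^sup>*" if "(?r x, b) \<in> R'\<^sup>*" "x \<in> S" for x b
    using that(1)
  proof induction
    case base
    then show ?case using same \<open>x \<in> S\<close> by simp
  next
    case (step b c)
    then have "b \<in> S'" "c \<in> S'" "{b, c} \<in> edges (contract e G)" by (simp_all add: R'_def)
    then obtain f where f: "f \<in> edges G" "?r ` f = {b, c}" and bc: "b \<subseteq> C" "c \<subseteq> C"
      unfolding edges_contract S'_def by auto
    obtain p q where pq: "f = {p, q}" "p \<in> vertices G" "q \<in> vertices G"
      using coalition_graph_edgeE[OF G f(1)] by metis
    \<comment> \<open>Edges are unordered, so the preimage may come in either orientation;
      \<open>b0\<close> and \<open>c0\<close> name its endpoints in the order of the path.\<close>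
    then have "?r p = b \<and> ?r q = c \<or> ?r q = b \<and> ?r p = c"
      using f(2) by (auto simp: doubleton_eq_iff)
    then obtain b0 c0 where bc0: "f = {b0, c0}" "?r b0 = b" "?r c0 = c"
      "b0 \<in> vertices G" "c0 \<in> vertices G"
      using pq by (metis insert_commute)
    then have S: "b0 \<in> S" "c0 \<in> S" using bc sub[of b0] sub[of c0] by (simp_all add: S_def)
    show ?case
    proof (intro ballI impI)
      fix y assume y: "y \<in> S" "?r y = c"
      have "(x, b0) \<in> R\<^sup>*" using step.IH S bc0 by simp
      also have "(b0, c0) \<in> R" using S f bc0 by (simp add: R_def)
      also have "(c0, y) \<in> R\<^sup>*" using same S y bc0 by simp
      finally show "(x, y) \<in> R\<^sup>*" .
    qed
  qed
  have "(\<forall>x\<in>S'. \<forall>y\<in>S'. (x, y) \<in> R'\<^sup>*) \<longleftrightarrow> (\<forall>x\<in>S. \<forall>y\<in>S. (x, y) \<in> R\<^sup>*)"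
    (is "?L \<longleftrightarrow> ?R")
  proof
    assume L: ?L
    show ?R
    proof (intro ballI)
      fix x y assume xy: "x \<in> S" "y \<in> S"
      then have "(?r x, ?r y) \<in> R'\<^sup>*" using L by (simp add: S')
      then show "(x, y) \<in> R\<^sup>*" using lift xy by blast
    qed
  next
    assume ?R
    then show ?L using push by (simp add: S')
  qed
  then show ?thesis
    unfolding induces_connected_def S_def S'_def R_def R'_def .
qed

lemma internal_redirect_iff:
  assumes G: "coalition_graph A G" and e: "e \<in> edges G" and CS: "partition_on A CS"
    and int: "internal CS e" and f: "f \<in> edges G"
  shows "internal CS (redirect e ` f) \<longleftrightarrow> internal CS f"
proof -
  have "f \<subseteq> vertices G" using G f by (auto simp: coalition_graph_def two_coloured_graph_def)
  then have "redirect e x \<subseteq> C \<longleftrightarrow> x \<subseteq> C" if "x \<in> f" "C \<in> CS" for x C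
    using redirect_subset_iff[OF G e CS int] that by blast
  then show ?thesis by (simp add: internal_def)
qed

text \<open>The refinement clause alone forces \<open>e\<close> to be internal; the other two
  clauses are compared only under that assumption. A merged edge is red iff one of its sources is
  red, and it is then internal iff any one of its sources is.\<close>

lemma compatible_contract_iff:
  assumes G: "coalition_graph A G" and e: "e \<in> green_edges G" and CS: "partition_on A CS"
  shows "compatible (contract e G) CS \<longleftrightarrow> compatible G CS \<and> internal CS e"
proof -
  have eE: "e \<in> edges G" and green: "colouring G e = Green"
    using e by (auto simp: green_edges_def)
  have P: "partition_on A (vertices G)" "partition_on A (vertices (contract e G))"
    using G coalition_graph_contract[OF G eE] by (simp_all add: coalition_graph_def)
  have red: "(\<forall>g\<in>edges (contract e G). colouring (contract e G) g = Red \<longrightarrow> \<not> internal CS g) \<longleftrightarrow>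
    (\<forall>f\<in>edges G. colouring G f = Red \<longrightarrow> \<not> internal CS f)" if int: "internal CS e"
  proof -
    have "(\<forall>g\<in>edges (contract e G). colouring (contract e G) g = Red \<longrightarrow> \<not> internal CS g) \<longleftrightarrow>
      (\<forall>f\<in>edges G - {e}. colouring G f = Red \<longrightarrow> \<not> internal CS (redirect e ` f))"
      (is "?L \<longleftrightarrow> ?R")
    proof
      assume L: ?L
      show ?R
      proof (intro ballI impI)
        fix f assume f: "f \<in> edges G - {e}" "colouring G f = Red"
        then have "redirect e ` f \<in> edges (contract e G)" by (simp add: edges_contract)
        moreover have "colouring (contract e G) (redirect e ` f) = Red"
          unfolding colouring_contract_Red_iff using f by (intro bexI[of _ f] conjI refl)
        ultimately show "\<not> internal CS (redirect e ` f)" using L by simp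
      qed
    next
      assume R: ?R
      show ?L
      proof (intro ballI impI)
        fix g assume "colouring (contract e G) g = Red"
        then obtain f where "f \<in> edges G - {e}" "redirect e ` f = g" "colouring G f = Red"
          unfolding colouring_contract_Red_iff by (elim bexE conjE)
        then show "\<not> internal CS g" using bspec[OF R, of f] by simp
      qed
    qed
    also have "\<dots> \<longleftrightarrow> (\<forall>f\<in>edges G - {e}. colouring G f = Red \<longrightarrow> \<not> internal CS f)"
      using internal_redirect_iff[OF G eE CS int] by simp
    \<comment> \<open>Since \<open>e\<close> is green, leaving it out drops no red edge.\<close>
    also have "\<dots> \<longleftrightarrow> (\<forall>f\<in>edges G. colouring G f = Red \<longrightarrow> \<not> internal CS f)"
      using green by auto
    finally show ?thesis .
  qed
  show ?thesis
    unfolding compatible_iff[OF P(1) CS] compatible_iff[OF P(2) CS] refines_contract_iff[OF G eE CS]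
    using red induces_connected_contract_iff[OF G eE CS]
    by (cases "internal CS e") simp_all
qed

section \<open>Recolouring and children\<close>

lemma compatible_recolour_red_iff:
  assumes "E \<subseteq> edges G"
  shows "compatible (recolour_red E G) CS \<longleftrightarrow> compatible G CS \<and> (\<forall>f\<in>E. \<not> internal CS f)"
proof -
  have "(\<forall>f\<in>edges G. (if f \<in> E then Red else colouring G f) = Red \<longrightarrow> \<not> internal CS f) \<longleftrightarrow>
    (\<forall>f\<in>edges G. colouring G f = Red \<longrightarrow> \<not> internal CS f) \<and> (\<forall>f\<in>E. \<not> internal CS f)"
    using assms by auto
  then show ?thesis
    by (simp add: compatible_def induces_connected_def recolour_red_def internal_def)
qed

text \<open>Distinctness keeps \<open>es ! i\<close> out of the recoloured prefix, so it is still
  green when it is contracted.\<close>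

lemma nth_green_edge_recolour_red:
  assumes "distinct es" "set es = green_edges G" "i < length es"
  shows "es ! i \<in> green_edges (recolour_red (set (take i es)) G)"
proof -
  have "es ! i \<notin> set (take i es)"
    using assms by (auto simp: in_set_conv_nth nth_eq_iff_index_eq)
  moreover have "es ! i \<in> green_edges G" using assms nth_mem by blast
  ultimately show ?thesis by (simp add: green_edges_def recolour_red_def)
qed

lemma coalition_graph_child:
  assumes "coalition_graph A G" "distinct es" "set es = green_edges G" "i < length es"
  shows "coalition_graph A (child G es i)"
  unfolding child_def
proof (rule coalition_graph_contract)
  show "es ! i \<in> edges (recolour_red (set (take i es)) G)"
    using nth_green_edge_recolour_red[OF assms(2-4)] by (simp add: green_edges_def)
qed (simp add: assms(1))

text \<open>As a first internal index is unique, at most one child is compatible with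
  \<open>CS\<close>.\<close>

lemma compatible_child_iff:
  assumes "coalition_graph A G" "distinct es" "set es = green_edges G" "i < length es"
    and "partition_on A CS"
  shows "compatible (child G es i) CS \<longleftrightarrow>
    compatible G CS \<and> internal CS (es ! i) \<and> (\<forall>j<i. \<not> internal CS (es ! j))"
proof -
  have "set (take i es) \<subseteq> edges G"
    using assms(3) set_take_subset[of i es] by (auto simp: green_edges_def)
  moreover have "set (take i es) = (!) es ` {..<i}"
    using assms(4) by (simp add: nth_image lessThan_atLeast0)
  ultimately show ?thesis
    unfolding child_def
    using compatible_contract_iff[OF _ nth_green_edge_recolour_red[OF assms(2-4)] assms(5)] assms(1)
    by (auto simp: compatible_recolour_red_iff)
qed

section \<open>Compatible structures without internal edges\<close>

lemma not_internal_vertices: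
  assumes G: "coalition_graph A G" and f: "f \<in> edges G"
  shows "\<not> internal (vertices G) f"
proof
  assume "internal (vertices G) f"
  then obtain C where C: "C \<in> vertices G" "\<forall>v\<in>f. v \<subseteq> C" by (auto simp: internal_def)
  have P: "partition_on A (vertices G)" using G by (simp add: coalition_graph_def)
  obtain u v where uv: "f = {u, v}" "u \<noteq> v" "u \<in> vertices G" "v \<in> vertices G" "u \<noteq> {}" "v \<noteq> {}"
    using coalition_graph_edgeE[OF G f] by metis
  then have "u = C" "v = C"
    using partition_on_subset_unique[OF P _ C(1), of u u]
      partition_on_subset_unique[OF P _ C(1), of v v] C by auto
  then show False using uv by simp
qed

text \<open>Each block contains a single vertex, namely itself, so connectedness is trivial.\<close>

lemma compatible_vertices:
  assumes G: "coalition_graph A G"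
  shows "compatible G (vertices G)"
proof -
  have P: "partition_on A (vertices G)" using G by (simp add: coalition_graph_def)
  have "{v \<in> vertices G. v \<subseteq> C} = {C}" if C: "C \<in> vertices G" for C
    using partition_on_subset_unique[OF P _ C] C P by (auto simp: partition_on_def)
  then show ?thesis
    unfolding compatible_iff[OF P P] using not_internal_vertices[OF G] P
    by (auto simp: refines_def induces_connected_def)
qed

lemma compatible_imp_eq_vertices_or_internal:
  assumes G: "coalition_graph A G" and CS: "partition_on A CS" and comp: "compatible G CS"
  shows "CS = vertices G \<or> (\<exists>f\<in>green_edges G. internal CS f)"
proof (rule disjCI)
  assume no: "\<not> (\<exists>f\<in>green_edges G. internal CS f)"
  have P: "partition_on A (vertices G)" using G by (simp add: coalition_graph_def)
  note c = comp[unfolded compatible_iff[OF P CS]]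
  \<comment> \<open>Red edges are excluded by compatibility, green ones by assumption.\<close>
  have none: "\<not> internal CS f" if "f \<in> edges G" for f
    using no c that by (cases "colouring G f") (auto simp: green_edges_def)
  have eq: "x = y" if "C \<in> CS" "x \<in> vertices G" "y \<in> vertices G" "x \<subseteq> C" "y \<subseteq> C" for C x y
  proof -
    let ?S = "{v \<in> vertices G. v \<subseteq> C}"
    \<comment> \<open>With no edge inside \<open>C\<close>, reachability there is equality, so
      connectedness leaves at most one vertex in \<open>C\<close>.\<close>
    have "{(u, v). u \<in> ?S \<and> v \<in> ?S \<and> {u, v} \<in> edges G} = {}"
      using none that(1) unfolding internal_def by blast
    moreover have "(x, y) \<in> {(u, v). u \<in> ?S \<and> v \<in> ?S \<and> {u, v} \<in> edges G}\<^sup>*"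
      using c that unfolding induces_connected_def by blast
    ultimately show ?thesis by (metis rtrancl_empty IdD)
  qed
  have mem: "C \<in> vertices G" if C: "C \<in> CS" for C
  proof -
    obtain W where W: "W \<subseteq> vertices G" "C = \<Union>W"
      using comp C unfolding compatible_def by blast
    moreover have "C \<noteq> {}" using CS C by (auto simp: partition_on_def)
    ultimately obtain x where x: "x \<in> W" by blast
    then have "W = {x}" using eq[OF C, of _ x] W by blast
    then show ?thesis using W by simp
  qed
  \<comment> \<open>The block \<open>C\<close> around \<open>x\<close> is itself a vertex, so it
    equals \<open>x\<close>.\<close>
  have "x \<in> CS" if x: "x \<in> vertices G" for x
  proof -
    obtain C where C: "C \<in> CS" "x \<subseteq> C" using c x by (auto simp: refines_def)
    then show ?thesis using eq[of C x C] mem x by auto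
  qed
  then show "CS = vertices G" using mem by blast
qed

section \<open>Positions in the search tree\<close>

lemma node_at_eq_Some_iff:
  "node_at (Node H ts) p = Some K \<longleftrightarrow>
    p = [] \<and> K = H \<or> (\<exists>i q. p = i # q \<and> i < length ts \<and> node_at (ts ! i) q = Some K)"
  by (cases p) auto

text \<open>Compatibility passes from child to parent, hence from each node up to the root. This
  rules out occurrences of \<open>CS\<close> below children incompatible with it. The partition
  conjunct is carried along because \<open>compatible_child_iff\<close> asks for it.\<close>

lemma node_at_imp_compatible:
  assumes "search_tree T" "coalition_graph A (root T)" "node_at T p = Some K"
  shows "compatible (root T) (vertices K) \<and> partition_on A (vertices K)"
  using assms
proof (induction arbitrary: p rule: search_tree.induct)
  case (1 es H ts)
  then have H: "coalition_graph A H" by simp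
  from "1.prems"(2) show ?case
    unfolding node_at_eq_Some_iff
  proof (elim disjE conjE exE)
    assume "K = H"
    then show ?thesis using compatible_vertices[OF H] H by (simp add: coalition_graph_def)
  next
    fix i q
    assume iq: "i < length ts" "node_at (ts ! i) q = Some K"
    then have i: "i < length es" using 1 by simp
    have "compatible (child H es i) (vertices K) \<and> partition_on A (vertices K)"
      using 1 iq i coalition_graph_child[OF H, of es i] by metis
    then show ?thesis using compatible_child_iff[OF H "1.hyps"(1,2) i] by auto
  qed
qed

text \<open>Compatibility determines the path: at each node either \<open>CS\<close> is reached or
  exactly one child can lead to it.\<close>

lemma search_tree_ex1_node:
  assumes "search_tree T" "coalition_graph A (root T)" "partition_on A CS" "compatible (root T) CS"
  shows "\<exists>!p. \<exists>K. node_at T p = Some K \<and> vertices K = CS"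
  using assms
proof (induction rule: search_tree.induct)
  case (1 es H ts)
  then have H: "coalition_graph A H" and comp: "compatible H CS" by simp_all
  note es = "1.hyps"(1,2)
  note child = compatible_child_iff[OF H es _ "1.prems"(2)]
  \<comment> \<open>Any occurrence of \<open>CS\<close> below child \<open>i\<close> makes
    \<open>i\<close> the first internal index.\<close>
  have step: "internal CS (es ! i) \<and> (\<forall>j<i. \<not> internal CS (es ! j))"
    if "i < length ts" "node_at (ts ! i) q = Some K" "vertices K = CS" for i q K
  proof -
    have i: "i < length es" using that 1 by simp
    then have "compatible (child H es i) CS"
      using node_at_imp_compatible[of "ts ! i" A q K] that 1 coalition_graph_child[OF H es i]
      by metis
    then show ?thesis using child[OF i] by blast
  qed
  show ?case
  proof (cases "CS = vertices H")
    case True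
    \<comment> \<open>Together with \<open>step\<close>, this excludes every position below a child,
      leaving only the root.\<close>
    have "\<not> internal CS (es ! i)" if "i < length ts" for i
    proof -
      have "es ! i \<in> edges H" using that 1 nth_mem[of i es] by (auto simp: green_edges_def)
      then show ?thesis using not_internal_vertices[OF H] True by simp
    qed
    then show ?thesis
      unfolding node_at_eq_Some_iff using step True by (intro ex1I[of _ "[]"]) blast+
  next
    case False
    then obtain f where f: "f \<in> set es" "internal CS f"
      using compatible_imp_eq_vertices_or_internal[OF H "1.prems"(2) comp] es by blast
    \<comment> \<open>The minimum ranges over all naturals, where \<open>es ! i\<close> may be
      unspecified; the valid index \<open>k\<close> bounds it below
      \<open>length es\<close>.\<close>
    define i where "i = (LEAST i. internal CS (es ! i))"
    obtain k where k: "k < length es" "internal CS (es ! k)"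
      using f by (auto simp: in_set_conv_nth)
    have i: "internal CS (es ! i)" "\<forall>j<i. \<not> internal CS (es ! j)" "i < length es"
      using LeastI[of "\<lambda>i. internal CS (es ! i)", OF k(2)] not_less_Least
        Least_le[of "\<lambda>i. internal CS (es ! i)", OF k(2)] k(1)
      unfolding i_def by (blast, blast, linarith)
    then have "compatible (child H es i) CS" using child comp by blast
    then have "\<exists>!q. \<exists>K. node_at (ts ! i) q = Some K \<and> vertices K = CS"
      using 1 i(3) coalition_graph_child[OF H es i(3)] by metis
    then obtain q where q: "\<exists>K. node_at (ts ! i) q = Some K \<and> vertices K = CS"
      and uniq: "\<And>q'. \<exists>K. node_at (ts ! i) q' = Some K \<and> vertices K = CS \<Longrightarrow> q' = q"
      by blast
    show ?thesis
    proof (rule ex1I[of _ "i # q"])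
      show "\<exists>K. node_at (Node H ts) (i # q) = Some K \<and> vertices K = CS"
        using q i(3) "1.hyps"(3) by simp
    next
      fix p assume "\<exists>K. node_at (Node H ts) p = Some K \<and> vertices K = CS"
      then obtain j r K where p: "p = j # r" "j < length ts" "node_at (ts ! j) r = Some K"
        "vertices K = CS"
        unfolding node_at_eq_Some_iff using False by blast
      \<comment> \<open>Both \<open>j\<close> and \<open>i\<close> are first internal
        indices.\<close>
      have "j = i" using step[OF p(2-4)] i(1,2) by (meson nat_neq_iff)
      then show "p = i # q" using p uniq by blast
    qed
  qed
qed

theorem proposition4p3:
  fixes A :: "'a set" and G :: "'a cgraph" and T :: "'a stree" and CS :: "'a set set"
  assumes "finite A"
    and "two_coloured_graph G"
    and "partition_on A (vertices G)"
    and "search_tree T" and "root T = G"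
    and "coalition_structure A CS" and "compatible G CS"
  shows "\<exists>!p. \<exists>H. node_at T p = Some H \<and> vertices H = CS"
  using assms by (intro search_tree_ex1_node)
    (simp_all add: coalition_graph_def coalition_structure_def)

end
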